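(* Let $(\mathcal{B},\mu)$ be a strictly positive atomless normalized measure algebra. If $N:[0,1]\to[0,1]$ satisfies $\mu(a^c)=N(\mu(a))$ for every $a\in\mathcal{B}$, then $N(x)=1-x$ for every $x\in[0,1]$.
   Context: A strictly positive atomless normalized measure algebra $(\mathcal{B},\mu)$ is a Dedekind $\sigma$-complete Boolean algebra $\mathcal{B}$ with a countably additive $\mu:\mathcal{B}\to[0,1]$ such that $\mu(1)=1$, $\mu(a)>0$ for every $a\neq 0$, and $\mathcal{B}$ has no atoms. $a^c$ denotes the Boolean complement of $a$. *)

theory Defs
  imports Complex_Main "HOL-Library.Countable_Complete_Lattices"
begin

definition is_atom :: "'a::boolean_algebra \<Rightarrow> bool" where
  "is_atom a \<longleftrightarrow> a \<noteq> bot \<and> (\<forall>b. b \<le> a \<longrightarrow> b = bot \<or> b = a)"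

(* The type is the algebra. In a Boolean algebra every set is bounded, so Dedekind
   sigma-completeness is the existence of all countable suprema and infima, i.e. the class
   countable_complete_lattice. The values of Sup and Inf on uncountable sets are irrelevant.
   The property \<mu> bot = 0 is not listed: it follows from countable additivity for the
   constant sequence bot. *)
locale strictly_positive_atomless_measure_algebra =
  fixes \<mu> :: "'a::{boolean_algebra, countable_complete_lattice} \<Rightarrow> real"
  assumes measure_range: "\<mu> a \<in> {0..1}"
    and countably_additive:
      "(\<And>m n. m \<noteq> n \<Longrightarrow> inf (A m) (A n) = bot) \<Longrightarrow>
        (\<lambda>n::nat. \<mu> (A n)) sums \<mu> (SUP n. A n)"
    and normalized: "\<mu> top = 1"
    and strictly_positive: "a \<noteq> bot \<Longrightarrow> \<mu> a > 0"
    and atomless: "\<not> is_atom (a::'a)"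

end

theory Submission
  imports Defs
begin

text \<open>By finite additivity it suffices that \<open>\<mu>\<close> attains every value \<open>x \<in> [0,1]\<close> (Sierpinski).
  Choose an increasing sequence with measure at most \<open>x\<close> greedily, the \<open>n\<close>-th choice being optimal
  up to \<open>1/(n+1)\<close>. Its supremum \<open>a\<close> is then maximal in measure among the elements above it of
  measure at most \<open>x\<close>. Atomlessness gives nonzero elements of arbitrarily small measure below
  \<open>- a\<close>, so \<open>\<mu> a < x\<close> is impossible.\<close>

context strictly_positive_atomless_measure_algebra
begin

lemma measure_bot: "\<mu> bot = 0"
proof -
  have "(\<lambda>n::nat. \<mu> bot) sums \<mu> (SUP n::nat. bot)"
    by (rule countably_additive) simp
  then have "(\<lambda>n::nat. \<mu> bot) \<longlonglongrightarrow> 0"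
    by (intro summable_LIMSEQ_zero sums_summable)
  then show ?thesis
    by (simp add: LIMSEQ_const_iff)
qed

lemma measure_sup:
  assumes "inf a b = bot"
  shows "\<mu> (sup a b) = \<mu> a + \<mu> b"
proof -
  \<comment> \<open>Padding the pair with \<open>bot\<close> makes countable additivity applicable;
    the padding contributes nothing because \<open>\<mu> bot = 0\<close>.\<close>
  define A where "A n = (if n = 0 then a else if n = Suc 0 then b else bot)" for n
  have "(SUP n. A n) = sup a b"
  proof (rule antisym)
    show "(SUP n. A n) \<le> sup a b"
      by (rule ccSUP_least) (auto simp: A_def)
    have "A 0 \<le> (SUP n. A n)" "A (Suc 0) \<le> (SUP n. A n)"
      by (intro ccSUP_upper; simp)+
    then show "sup a b \<le> (SUP n. A n)"
      by (simp add: A_def)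
  qed
  moreover have "(\<lambda>n. \<mu> (A n)) sums \<mu> (SUP n. A n)"
    by (rule countably_additive) (use assms in \<open>auto simp: A_def inf_commute\<close>)
  moreover have "(\<lambda>n. \<mu> (A n)) sums (\<Sum>n\<in>{0, Suc 0}. \<mu> (A n))"
    by (rule sums_finite) (auto simp: A_def measure_bot)
  ultimately show ?thesis
    by (auto simp: A_def dest: sums_unique2)
qed

lemma measure_diff:
  assumes "a \<le> b"
  shows "\<mu> (b - a) = \<mu> b - \<mu> a"
proof -
  have "sup a (b - a) = b"
    using assms by (simp add: diff_eq sup_inf_distrib1 sup_absorb2)
  moreover have "inf a (b - a) = bot"
    by (simp add: diff_eq inf_left_commute)
  ultimately show ?thesis
    using measure_sup[of a "b - a"] by simp
qed

lemma measure_mono: "a \<le> b \<Longrightarrow> \<mu> a \<le> \<mu> b"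
  using measure_diff[of a b] measure_range[of "b - a"] by simp

lemma measure_compl: "\<mu> (- a) = 1 - \<mu> a"
  using measure_diff[of a top] by (simp add: diff_eq normalized)

text \<open>The increments \<open>D n\<close> of the chain are pairwise disjoint: for m < n,
  \<open>D m\<close> lies below \<open>A (n - 1)\<close> and \<open>D n\<close> below its
  complement. Their measures telescope to \<open>\<mu> (A n)\<close>, so countable additivity gives
  the measure of the supremum as a limit of values at most \<open>x\<close>.\<close>

lemma measure_SUP_incseq_le:
  assumes "incseq A" and bound: "\<And>n. \<mu> (A n) \<le> x"
  shows "\<mu> (SUP n. A n) \<le> x"
proof -
  define D where "D n = (case n of 0 \<Rightarrow> A 0 | Suc m \<Rightarrow> A (Suc m) - A m)" for n
  have D_Suc: "D (Suc n) = A (Suc n) - A n" for n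
    by (simp add: D_def)
  have D_le: "D n \<le> A n" for n
    by (cases n) (simp_all add: D_def diff_eq)
  have disjoint_less: "inf (D m) (D n) = bot" if "m < n" for m n
  proof -
    obtain k where k: "n = Suc k"
      using \<open>m < n\<close> by (cases n) auto
    have "D m \<le> A k"
      using D_le[of m] incseqD[OF \<open>incseq A\<close>, of m k] that k by auto
    moreover have "D n \<le> - A k"
      by (simp add: k D_Suc diff_eq)
    ultimately have "inf (D m) (D n) \<le> inf (A k) (- A k)"
      by (rule inf_mono)
    then show ?thesis
      by (simp add: le_bot)
  qed
  have "inf (D m) (D n) = bot" if "m \<noteq> n" for m n
    using that disjoint_less[of m n] disjoint_less[of n m]
    by (auto simp: inf_commute neq_iff)
  then have "(\<lambda>n. \<mu> (D n)) sums \<mu> (SUP n. D n)"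
    by (rule countably_additive)
  moreover have "(\<Sum>i<Suc n. \<mu> (D i)) = \<mu> (A n)" for n
  proof (induction n)
    case 0
    then show ?case by (simp add: D_def)
  next
    case (Suc n)
    then show ?case
      using measure_diff[of "A n" "A (Suc n)"] incseq_SucD[OF \<open>incseq A\<close>, of n]
      by (simp add: D_Suc)
  qed
  \<comment> \<open>The partial sum over the first \<open>Suc n\<close> increments is
    \<open>\<mu> (A n)\<close>, so the sequence of partial sums is shifted by one.\<close>
  ultimately have "(\<lambda>n. \<mu> (A n)) \<longlonglongrightarrow> \<mu> (SUP n. D n)"
    by (simp add: sums_def filterlim_sequentially_Suc[symmetric, of "\<lambda>n. sum _ {..<n}"])
  then have "\<mu> (SUP n. D n) \<le> x"
    by (rule LIMSEQ_le_const2) (use bound in auto)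
  \<comment> \<open>The bound on the supremum of the increments passes to the supremum of the chain,
    since \<open>A (Suc n)\<close> is covered by \<open>A n\<close> and
    \<open>D (Suc n)\<close>.\<close>
  moreover have "A n \<le> (SUP n. D n)" for n
  proof (induction n)
    case 0
    have "D 0 \<le> (SUP n. D n)"
      by (intro ccSUP_upper) auto
    then show ?case by (simp add: D_def)
  next
    case (Suc n)
    have "D (Suc n) \<le> (SUP n. D n)"
      by (intro ccSUP_upper) auto
    moreover have "A (Suc n) \<le> sup (A n) (D (Suc n))"
      by (simp add: D_Suc diff_eq sup_inf_distrib1)
    ultimately show ?case
      using Suc by (meson le_sup_iff order_trans sup.bounded_iff)
  qed
  then have "\<mu> (SUP n. A n) \<le> \<mu> (SUP n. D n)"
    by (intro measure_mono ccSUP_least) auto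
  ultimately show ?thesis by simp
qed

text \<open>A non-atom splits into two nonzero disjoint parts \<open>c\<close> and
  \<open>a - c\<close>. Their measures add up to \<open>\<mu> a\<close>, so one of them has at most
  half of it.\<close>

lemma nonzero_half_below:
  assumes "a \<noteq> bot"
  obtains b where "b \<le> a" "b \<noteq> bot" "\<mu> b \<le> \<mu> a / 2"
proof -
  obtain c where c: "c \<le> a" "c \<noteq> bot" "c \<noteq> a"
    using atomless[of a] assms by (auto simp: is_atom_def)
  have "a - c \<noteq> bot"
  proof
    assume "a - c = bot"
    then have "a \<le> c"
      by (simp add: diff_eq inf_shunt)
    then show False
      using c by auto
  qed
  moreover have "a - c \<le> a"
    by (simp add: diff_eq)
  ultimately show thesis
    using that[of c] that[of "a - c"] c measure_diff[OF \<open>c \<le> a\<close>]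
    by (cases "\<mu> c \<le> \<mu> a / 2") auto
qed

text \<open>Halving is iterated, starting from \<open>a\<close> itself, whose measure is at most 1 =
  \<open>(1/2) ^ 0\<close>.\<close>

lemma nonzero_small_below:
  assumes "a \<noteq> bot" "\<epsilon> > 0"
  obtains b where "b \<le> a" "b \<noteq> bot" "\<mu> b < \<epsilon>"
proof -
  have ex: "\<exists>b\<le>a. b \<noteq> bot \<and> \<mu> b \<le> (1/2) ^ n" for n
  proof (induction n)
    case 0
    then show ?case
      using assms measure_range[of a] by auto
  next
    case (Suc n)
    then obtain b where b: "b \<le> a" "b \<noteq> bot" "\<mu> b \<le> (1/2) ^ n"
      by auto
    obtain c where "c \<le> b" "c \<noteq> bot" "\<mu> c \<le> \<mu> b / 2"
      using nonzero_half_below[OF \<open>b \<noteq> bot\<close>] .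
    with b show ?case
      by (intro exI[of _ c]) auto
  qed
  obtain n where "(1/2) ^ n < \<epsilon>"
    using real_arch_pow_inv[OF \<open>\<epsilon> > 0\<close>, of "1/2"] by auto
  then show thesis
    using ex[of n] that by fastforce
qed

text \<open>This is one greedy step: \<open>c\<close> comes within \<open>\<epsilon>\<close> of the
  supremum of the measures still allowed above \<open>a\<close>, a set that contains
  \<open>\<mu> a\<close>.\<close>

lemma near_maximal_above:
  assumes "\<mu> a \<le> x" "\<epsilon> > 0"
  obtains c where "a \<le> c" "\<mu> c \<le> x" "\<And>b. a \<le> b \<Longrightarrow> \<mu> b \<le> x \<Longrightarrow> \<mu> b \<le> \<mu> c + \<epsilon>"
proof -
  let ?S = "\<mu> ` {b. a \<le> b \<and> \<mu> b \<le> x}"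
  have bdd: "bdd_above ?S"
    by (rule bdd_aboveI[of _ x]) auto
  have "?S \<noteq> {}"
    using assms by auto
  then obtain y where "y \<in> ?S" "Sup ?S - \<epsilon> < y"
    using less_cSup_iff[OF _ bdd, of "Sup ?S - \<epsilon>"] assms by auto
  then obtain c where c: "a \<le> c" "\<mu> c \<le> x" "Sup ?S - \<epsilon> < \<mu> c"
    by auto
  show thesis
  proof (rule that[OF c(1,2)])
    fix b
    assume "a \<le> b" "\<mu> b \<le> x"
    then have "\<mu> b \<le> Sup ?S"
      by (intro cSup_upper bdd) auto
    with c(3) show "\<mu> b \<le> \<mu> c + \<epsilon>"
      by simp
  qed
qed

lemma measure_attains:
  assumes "x \<in> {0..1}"
  obtains a where "\<mu> a = x"
proof -
  \<comment> \<open>The bound by \<open>x\<close> is the invariant under which the next greedy step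
    can be taken.\<close>
  have "\<exists>A. \<forall>n. \<mu> (A n) \<le> x \<and> (A n \<le> A (Suc n) \<and>
      (\<forall>b. A n \<le> b \<longrightarrow> \<mu> b \<le> x \<longrightarrow> \<mu> b \<le> \<mu> (A (Suc n)) + 1 / real (Suc n)))"
  proof (rule dependent_nat_choice)
    show "\<exists>a. \<mu> a \<le> x"
      using assms by (intro exI[of _ bot]) (simp add: measure_bot)
    fix a and n :: nat
    assume "\<mu> a \<le> x"
    then show "\<exists>c. \<mu> c \<le> x \<and> (a \<le> c \<and>
        (\<forall>b. a \<le> b \<longrightarrow> \<mu> b \<le> x \<longrightarrow> \<mu> b \<le> \<mu> c + 1 / real (Suc n)))"
      by (rule near_maximal_above[of a x "1 / real (Suc n)"]) auto
  qed
  then obtain A where A_le: "\<And>n. \<mu> (A n) \<le> x" and A_Suc: "\<And>n. A n \<le> A (Suc n)"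
    and A_max: "\<And>n b. A n \<le> b \<Longrightarrow> \<mu> b \<le> x \<Longrightarrow> \<mu> b \<le> \<mu> (A (Suc n)) + 1 / real (Suc n)"
    by blast
  define a where "a = (SUP n. A n)"
  have A_a: "A n \<le> a" for n
    unfolding a_def by (intro ccSUP_upper) auto
  have a_le: "\<mu> a \<le> x"
    unfolding a_def using A_le A_Suc by (intro measure_SUP_incseq_le incseq_SucI)
  \<comment> \<open>An element above \<open>a\<close> is above every \<open>A n\<close>, so it was a
    candidate at every stage and exceeds \<open>\<mu> a\<close> by at most
    \<open>1 / real (Suc n)\<close> for each \<open>n\<close>.\<close>
  have a_max: "\<mu> b \<le> \<mu> a" if "a \<le> b" "\<mu> b \<le> x" for b
  proof (rule field_le_epsilon)
    fix e :: real
    assume "e > 0"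
    then obtain n where "1 / real (Suc n) < e"
      using nat_approx_posE by blast
    moreover have "\<mu> b \<le> \<mu> (A (Suc n)) + 1 / real (Suc n)"
      using A_max[OF order_trans[OF A_a that(1)] that(2)] .
    moreover have "\<mu> (A (Suc n)) \<le> \<mu> a"
      by (intro measure_mono A_a)
    ultimately show "\<mu> b \<le> \<mu> a + e"
      by linarith
  qed
  have "\<mu> a = x"
  proof (rule ccontr)
    assume "\<mu> a \<noteq> x"
    with a_le have less: "\<mu> a < x" by simp
    \<comment> \<open>Otherwise \<open>\<mu> a\<close> would be 1, which is at least
      \<open>x\<close>.\<close>
    then have "- a \<noteq> bot"
      using measure_compl[of a] measure_bot assms by auto
    then obtain c where c: "c \<le> - a" "c \<noteq> bot" "\<mu> c < x - \<mu> a"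
      using nonzero_small_below[of "- a" "x - \<mu> a"] less by auto
    from c(1) have "inf c a = bot"
      by (simp add: inf_shunt)
    then have "inf a c = bot"
      by (simp add: inf_commute)
    then have "\<mu> (sup a c) = \<mu> a + \<mu> c"
      by (rule measure_sup)
    \<comment> \<open>The measure of \<open>sup a c\<close> lies strictly between
      \<open>\<mu> a\<close> and \<open>x\<close>, against the maximality of
      \<open>a\<close>.\<close>
    with a_max[of "sup a c"] c strictly_positive[of c] show False
      by simp
  qed
  then show thesis by (rule that)
qed

end

theorem proposition1:
  fixes \<mu> :: "'a::{boolean_algebra, countable_complete_lattice} \<Rightarrow> real"
    and N :: "real \<Rightarrow> real"
  assumes "strictly_positive_atomless_measure_algebra \<mu>"
    and "\<And>x. x \<in> {0..1} \<Longrightarrow> N x \<in> {0..1}"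
    and "\<And>a. \<mu> (- a) = N (\<mu> a)"
  shows "\<forall>x\<in>{0..1}. N x = 1 - x"
proof
  interpret strictly_positive_atomless_measure_algebra \<mu>
    by (rule assms(1))
  fix x :: real
  assume "x \<in> {0..1}"
  then obtain a where "\<mu> a = x"
    by (rule measure_attains)
  then show "N x = 1 - x"
    using assms(3)[of a] measure_compl[of a] by simp
qed

end
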